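(* Let $N\ge2$ be an integer, $R>0$, $1<p<\infty$, $\alpha\in\mathbb{R}$ and $\beta\ge1-p$. Then the inequality $$\left(\frac{\beta+p-1}{p}\right)^p\int_{B_R}\frac{|u|^p}{|x|^{\alpha+p}\left(\log\frac{R}{|x|}\right)^{\beta+p}}\,dx+\tilde\psi_{N,p,\alpha,\beta}(u)\le\int_{B_R}\frac{\left|\nabla u\cdot\frac{x}{|x|}\right|^p}{|x|^\alpha\left(\log\frac{R}{|x|}\right)^\beta}\,dx$$ holds for any $u\in C_c^1(B_R)$ if $\alpha\le N-p$, and holds for any $u\in C_c^1(B_R\setminus\{0\})$ if $\alpha>N-p$, where $$\tilde\psi_{N,p,\alpha,\beta}(u)=(N-p-\alpha)\left(\frac{\beta+p-1}{p}\right)^{p-1}\int_{B_R}\frac{|u|^p}{|x|^{p+\alpha}\left(\log\frac{R}{|x|}\right)^{\beta+p-1}}\,dx.$$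
   Context: $B_R\subset\mathbb{R}^N$ is the open ball of radius $R$ centered at $0$. A term whose constant prefactor is $0$ is understood to be $0$, even if the accompanying integral diverges (in particular $\tilde\psi_{N,p,\alpha,\beta}(u)=0$ when $\alpha=N-p$). *)

theory Defs
  imports "HOL-Analysis.Analysis"
begin

definition grad :: "('a::real_inner \<Rightarrow> real) \<Rightarrow> 'a \<Rightarrow> 'a" where
  "grad u x = (THE g. GDERIV u x :> g)"

(* Elements of C_c^1(\<Omega>) are identified with their extension by zero to the whole space,
   so the support is a closure in the whole space. *)
definition C1c :: "('a::euclidean_space) set \<Rightarrow> ('a \<Rightarrow> real) set" where
  "C1c \<Omega> = {u. (\<forall>x\<in>\<Omega>. u differentiable (at x)) \<and> continuous_on \<Omega> (grad u)
              \<and> compact (closure {x. u x \<noteq> 0}) \<and> closure {x. u x \<noteq> 0} \<subseteq> \<Omega>}"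

(* Integral over the ball of radius R of a nonnegative function, as a value in [0,\<infinity>].
   It is embedded into the extended reals so that it may carry a negative prefactor;
   there 0 * \<infinity> = 0. *)
definition ball_integral :: "real \<Rightarrow> ('a::euclidean_space \<Rightarrow> real) \<Rightarrow> ereal" where
  "ball_integral R f = enn2ereal (\<integral>\<^sup>+x\<in>ball 0 R. ennreal (f x) \<partial>lborel)"

definition psi_tilde ::
  "real \<Rightarrow> real \<Rightarrow> real \<Rightarrow> real \<Rightarrow> (real ^ 'n \<Rightarrow> real) \<Rightarrow> ereal" where
  "psi_tilde R p \<alpha> \<beta> u =
     ereal ((real CARD('n) - p - \<alpha>) * ((\<beta> + p - 1) / p) powr (p - 1)) *
     ball_integral R (\<lambda>x. \<bar>u x\<bar> powr p /
       (norm x powr (p + \<alpha>) * ln (R / norm x) powr (\<beta> + p - 1)))"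

end

theory Submission
  imports Defs
begin

text \<open>
  On a ray put \<open>L = ln (R / s)\<close>, \<open>g = (\<beta> + p - 1) / p\<close> and \<open>a = N - p - \<alpha>\<close>. By Young's inequality the
  ray integrand of the left side minus that of the right side is at most the derivative of
  \<open>\<Phi> s = g powr (p - 1) * \<bar>u\<bar> powr p * s powr a * L powr (- p * g)\<close>. Since \<open>\<Phi> \<ge> 0\<close>, and \<open>\<Phi>\<close> vanishes
  near \<open>s = R\<close>, integrating over \<open>{\<epsilon>..T}\<close> and letting \<open>\<epsilon>\<close> tend to 0 gives the inequality on each ray,
  without any analysis of the boundary term at 0. For \<open>a < 0\<close> the term with coefficient \<open>a\<close> is kept on the
  right until the end; it can be subtracted because it is finite when \<open>u\<close> vanishes near 0.
\<close>

section \<open>Integration along rays\<close>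

text \<open>The value is \<open>ln r - ln (r / exp 1)\<close>. It normalizes the averaging weight by
  which an integral over the space is split into integrals over rays.\<close>

lemma nn_integral_inverse_interval:
  fixes r :: real
  assumes "r > 0"
  shows "(\<integral>\<^sup>+t. ennreal (1 / t) * indicator {r / exp 1..r} t \<partial>lborel) = 1"
proof -
  have le: "r / exp 1 \<le> r" using assms by (simp add: field_simps)
  have "((\<lambda>t. 1 / t) has_integral ln r - ln (r / exp 1)) {r / exp 1..r}"
  proof (rule fundamental_theorem_of_calculus[OF le])
    fix t assume "t \<in> {r / exp 1..r}"
    moreover have "0 < r / exp 1" using assms by simp
    ultimately have "t > 0" by (simp only: atLeastAtMost_iff) linarith
    then have "(ln has_real_derivative 1 / t) (at t)"
      by (auto intro!: derivative_eq_intros simp: field_simps)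
    then show "(ln has_vector_derivative 1 / t) (at t within {r / exp 1..r})"
      by (simp add: has_real_derivative_iff_has_vector_derivative has_vector_derivative_at_within)
  qed
  moreover have "0 \<le> 1 / t" if "t \<in> {r / exp 1..r}" for t
  proof -
    have "0 < r / exp 1" using assms by simp
    then have "0 < t" using that by (simp only: atLeastAtMost_iff) linarith
    then show ?thesis by simp
  qed
  ultimately have "(\<integral>\<^sup>+t. ennreal (1 / t) * indicator {r / exp 1..r} t \<partial>lborel)
      = ennreal (ln r - ln (r / exp 1))"
    by (intro nn_integral_has_integral_lebesgue')
  then show ?thesis using assms by (simp add: ln_div)
qed

lemma nn_integral_scaleR:
  fixes f :: "'a::euclidean_space \<Rightarrow> ennreal"
  assumes [measurable]: "f \<in> borel_measurable borel" and c: "c > 0"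
  shows "(\<integral>\<^sup>+x. f x \<partial>lborel) = ennreal (c ^ DIM('a)) * (\<integral>\<^sup>+x. f (c *\<^sub>R x) \<partial>lborel)"
  using c
  by (subst lborel_affine[of c 0])
     (simp_all add: nn_integral_density nn_integral_distr nn_integral_cmult)

text \<open>A substitute for polar coordinates: the weight \<open>1/t\<close> on \<open>norm y / exp 1 \<le> t \<le> norm y\<close> has
  total mass one, and rescaling by \<open>t\<close> moves that condition to an annulus.\<close>

lemma nn_integral_rays:
  fixes f :: "'a::euclidean_space \<Rightarrow> ennreal"
  assumes [measurable]: "f \<in> borel_measurable borel"
  shows "(\<integral>\<^sup>+x. f x \<partial>lborel) =
    (\<integral>\<^sup>+x. indicator {x. 1 \<le> norm x \<and> norm x \<le> exp 1} x *
      (\<integral>\<^sup>+t. ennreal (t ^ (DIM('a) - 1)) * f (t *\<^sub>R x) * indicator {0<..} t \<partial>lborel) \<partial>lborel)"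
proof -
  define h :: "real \<Rightarrow> 'a \<Rightarrow> ennreal" where
    "h t y = ennreal (1 / t) * (if 0 < t \<and> norm y / exp 1 \<le> t \<and> t \<le> norm y then 1 else 0)" for t y
  have [measurable]: "case_prod h \<in> borel_measurable (borel \<Otimes>\<^sub>M borel)"
    unfolding h_def by measurable
  have h1: "(\<integral>\<^sup>+t. h t y \<partial>lborel) = 1" if "y \<noteq> 0" for y
  proof -
    have "0 < norm y / exp 1" using that by simp
    then have "h t y = ennreal (1 / t) * indicator {norm y / exp 1..norm y} t" for t
      by (auto simp: h_def indicator_def simp del: zero_less_divide_iff zero_less_norm_iff)
    then show ?thesis using nn_integral_inverse_interval[of "norm y"] that by simp
  qed
  \<comment> \<open>At \<open>y = 0\<close> the weight has mass 0 instead of 1, but a single point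
    is a null set.\<close>
  have "(\<integral>\<^sup>+x. f x \<partial>lborel) = (\<integral>\<^sup>+y. f y * (\<integral>\<^sup>+t. h t y \<partial>lborel) \<partial>lborel)"
    using AE_lborel_singleton[of "0::'a"]
    by (intro nn_integral_cong_AE) (auto simp: h1)
  also have "\<dots> = (\<integral>\<^sup>+y. (\<integral>\<^sup>+t. f y * h t y \<partial>lborel) \<partial>lborel)"
    by (simp add: nn_integral_cmult)
  also have "\<dots> = (\<integral>\<^sup>+t. (\<integral>\<^sup>+y. f y * h t y \<partial>lborel) \<partial>lborel)"
    by (rule lborel_pair.Fubini') simp
  also have "\<dots> = (\<integral>\<^sup>+t. (\<integral>\<^sup>+x. indicator {x. 1 \<le> norm x \<and> norm x \<le> exp 1} x *
      (ennreal (t ^ (DIM('a) - 1)) * f (t *\<^sub>R x) * indicator {0<..} t) \<partial>lborel) \<partial>lborel)"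
  proof (rule nn_integral_cong)
    fix t :: real
    show "(\<integral>\<^sup>+y. f y * h t y \<partial>lborel) = (\<integral>\<^sup>+x. indicator {x. 1 \<le> norm x \<and> norm x \<le> exp 1} x *
      (ennreal (t ^ (DIM('a) - 1)) * f (t *\<^sub>R x) * indicator {0<..} t) \<partial>lborel)"
    proof (cases "t > 0")
      case True
      \<comment> \<open>One factor \<open>t\<close> of the Jacobian of
        \<open>y = t *\<^sub>R x\<close> cancels against the weight \<open>1 / t\<close>; what
        remains is the usual polar weight.\<close>
      have pow: "t ^ DIM('a) * (1 / t) = t ^ (DIM('a) - 1)"
        using True DIM_positive[where 'a='a] by (simp add: power_diff)
      have "(\<integral>\<^sup>+y. f y * h t y \<partial>lborel)
          = ennreal (t ^ DIM('a)) * (\<integral>\<^sup>+x. f (t *\<^sub>R x) * h t (t *\<^sub>R x) \<partial>lborel)"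
        by (intro nn_integral_scaleR True) simp
      also have "\<dots> = (\<integral>\<^sup>+x. ennreal (t ^ DIM('a)) * (f (t *\<^sub>R x) * h t (t *\<^sub>R x)) \<partial>lborel)"
        by (simp add: nn_integral_cmult)
      also have "\<dots> = (\<integral>\<^sup>+x. indicator {x. 1 \<le> norm x \<and> norm x \<le> exp 1} x *
      (ennreal (t ^ (DIM('a) - 1)) * f (t *\<^sub>R x) * indicator {0<..} t) \<partial>lborel)"
      proof (intro nn_integral_cong)
        fix x :: 'a
        have "t * norm x / exp 1 \<le> t \<longleftrightarrow> norm x \<le> exp 1" "t \<le> t * norm x \<longleftrightarrow> 1 \<le> norm x"
          using True by (simp_all add: field_simps)
        then have h: "h t (t *\<^sub>R x) = ennreal (1 / t) * indicator {x. 1 \<le> norm x \<and> norm x \<le> exp 1} x"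
          using True by (auto simp: h_def indicator_def)
        have c: "ennreal (t ^ DIM('a)) * ennreal (1 / t) = ennreal (t ^ (DIM('a) - 1))"
          using True pow by (subst ennreal_mult[symmetric]) auto
        have "ennreal (t ^ DIM('a)) * (f (t *\<^sub>R x) * h t (t *\<^sub>R x)) =
          (ennreal (t ^ DIM('a)) * ennreal (1 / t)) *
            (f (t *\<^sub>R x) * indicator {x. 1 \<le> norm x \<and> norm x \<le> exp 1} x)"
          unfolding h by (simp only: mult_ac)
        then show "ennreal (t ^ DIM('a)) * (f (t *\<^sub>R x) * h t (t *\<^sub>R x)) =
          indicator {x. 1 \<le> norm x \<and> norm x \<le> exp 1} x *
          (ennreal (t ^ (DIM('a) - 1)) * f (t *\<^sub>R x) * indicator {0<..} t)"
          using True unfolding c by (simp add: mult_ac)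
      qed
      finally show ?thesis .
    qed (simp add: h_def)
  qed
  also have "\<dots> = (\<integral>\<^sup>+x. (\<integral>\<^sup>+t. indicator {x. 1 \<le> norm x \<and> norm x \<le> exp 1} x *
      (ennreal (t ^ (DIM('a) - 1)) * f (t *\<^sub>R x) * indicator {0<..} t) \<partial>lborel) \<partial>lborel)"
    by (rule lborel_pair.Fubini') simp
  also have "\<dots> = (\<integral>\<^sup>+x. indicator {x. 1 \<le> norm x \<and> norm x \<le> exp 1} x *
      (\<integral>\<^sup>+t. ennreal (t ^ (DIM('a) - 1)) * f (t *\<^sub>R x) * indicator {0<..} t \<partial>lborel) \<partial>lborel)"
    by (simp add: nn_integral_cmult)
  finally show ?thesis .
qed

text \<open>Passing from \<open>x \<noteq> 0\<close> to the unit vector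
  \<open>x /\<^sub>R norm x\<close> multiplies the ray integrals of \<open>f\<close> and
  \<open>g\<close> by the same factor \<open>?c x\<close>. So the comparison on unit vectors extends
  to all of the annulus, where \<open>nn_integral_rays\<close> integrates it.\<close>

lemma nn_integral_mono_rays:
  fixes f g :: "'a::euclidean_space \<Rightarrow> ennreal"
  assumes [measurable]: "f \<in> borel_measurable borel" "g \<in> borel_measurable borel"
    and le: "\<And>e. norm e = 1 \<Longrightarrow>
      (\<integral>\<^sup>+s. ennreal (s ^ (DIM('a) - 1)) * f (s *\<^sub>R e) * indicator {0<..} s \<partial>lborel) \<le>
      (\<integral>\<^sup>+s. ennreal (s ^ (DIM('a) - 1)) * g (s *\<^sub>R e) * indicator {0<..} s \<partial>lborel)"
  shows "(\<integral>\<^sup>+x. f x \<partial>lborel) \<le> (\<integral>\<^sup>+x. g x \<partial>lborel)"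
proof -
  let ?c = "\<lambda>x::'a. ennreal (1 / norm x) * ennreal ((1 / norm x) ^ (DIM('a) - 1))"
  let ?I = "\<lambda>k x. (\<integral>\<^sup>+s. ennreal (s ^ (DIM('a) - 1)) * k (s *\<^sub>R x) * indicator {0<..} s \<partial>lborel)"
  have ray: "?I k x = ?c x * ?I k (x /\<^sub>R norm x)"
    if [measurable]: "k \<in> borel_measurable borel" and "x \<noteq> 0" for k and x :: 'a
  proof -
    \<comment> \<open>Substitute \<open>s / norm x\<close> for \<open>s\<close>.\<close>
    have "?I k x = ennreal \<bar>1 / norm x\<bar> * (\<integral>\<^sup>+s. ennreal ((0 + 1 / norm x * s) ^ (DIM('a) - 1)) *
        k ((0 + 1 / norm x * s) *\<^sub>R x) * indicator {0<..} (0 + 1 / norm x * s) \<partial>lborel)"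
      using that by (intro nn_integral_real_affine) auto
    also have "\<dots> = ennreal (1 / norm x) * (\<integral>\<^sup>+s. ennreal ((1 / norm x) ^ (DIM('a) - 1)) *
        (ennreal (s ^ (DIM('a) - 1)) * k (s *\<^sub>R (x /\<^sub>R norm x)) * indicator {0<..} s) \<partial>lborel)"
    proof -
      have "ennreal ((0 + 1 / norm x * s) ^ (DIM('a) - 1)) *
          k ((0 + 1 / norm x * s) *\<^sub>R x) * indicator {0<..} (0 + 1 / norm x * s)
        = ennreal ((1 / norm x) ^ (DIM('a) - 1)) *
        (ennreal (s ^ (DIM('a) - 1)) * k (s *\<^sub>R (x /\<^sub>R norm x)) * indicator {0<..} s)" for s
      proof (cases "s > 0")
        case True
        have "ennreal ((0 + 1 / norm x * s) ^ (DIM('a) - 1))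
          = ennreal ((1 / norm x) ^ (DIM('a) - 1)) * ennreal (s ^ (DIM('a) - 1))"
          unfolding add_0 power_mult_distrib using True by (subst ennreal_mult) auto
        moreover have "(0 + 1 / norm x * s) *\<^sub>R x = s *\<^sub>R (x /\<^sub>R norm x)"
          by (simp add: field_simps)
        moreover have "0 < 0 + 1 / norm x * s" using True that by simp
        ultimately show ?thesis using True by (simp only: indicator_simps greaterThan_iff mult.assoc)
      next
        case False
        then have "\<not> 0 < 0 + 1 / norm x * s" using that by (simp add: zero_less_mult_iff zero_less_divide_iff)
        then show ?thesis using False by (simp only: indicator_def greaterThan_iff) simp
      qed
      then show ?thesis by simp
    qed
    also have "\<dots> = ?c x * ?I k (x /\<^sub>R norm x)"
      by (subst nn_integral_cmult) (simp_all add: mult.assoc)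
    finally show ?thesis .
  qed
  have "?I f x \<le> ?I g x" if "x \<noteq> 0" for x :: 'a
    unfolding ray[OF assms(1) that] ray[OF assms(2) that]
    using that by (intro mult_left_mono le) auto
  \<comment> \<open>The origin, where no rescaling is possible, lies outside the annulus.\<close>
  then have "indicator {x. 1 \<le> norm x \<and> norm x \<le> exp 1} x * ?I f x
    \<le> indicator {x. 1 \<le> norm x \<and> norm x \<le> exp 1} x * ?I g x" for x :: 'a
    by (cases "x = 0") (auto intro!: mult_left_mono)
  then show ?thesis
    unfolding nn_integral_rays[OF assms(1)] nn_integral_rays[OF assms(2)]
    by (intro nn_integral_mono)
qed

section \<open>The one-dimensional inequality on an interval away from 0\<close>

text \<open>Because \<open>p > 1\<close>, the power smooths the corner of the absolute value, so
  zeros and sign changes of \<open>u\<close> along a ray do no harm.\<close>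

lemma DERIV_abs_powr:
  fixes p y :: real
  assumes "p > 1"
  shows "((\<lambda>y. \<bar>y\<bar> powr p) has_real_derivative p * \<bar>y\<bar> powr (p - 1) * sgn y) (at y)"
proof -
  consider "y > 0" | "y < 0" | "y = 0" by linarith
  then show ?thesis
  proof cases
    case 1
    have "((\<lambda>y. y powr p) has_real_derivative p * y powr (p - 1)) (at y)"
      using 1 by (auto intro!: derivative_eq_intros simp: powr_diff)
    then have "((\<lambda>y. \<bar>y\<bar> powr p) has_real_derivative p * y powr (p - 1)) (at y)"
      by (rule has_field_derivative_transform_within_open[where S = "{0<..}"]) (use 1 in auto)
    then show ?thesis using 1 by simp
  next
    case 2
    have "((\<lambda>y. (- y) powr p) has_real_derivative p * (- y) powr (p - 1) * (- 1)) (at y)"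
      using 2 by (auto intro!: derivative_eq_intros simp: powr_diff)
    then have "((\<lambda>y. \<bar>y\<bar> powr p) has_real_derivative p * (- y) powr (p - 1) * (- 1)) (at y)"
      by (rule has_field_derivative_transform_within_open[where S = "{..<0}"]) (use 2 in auto)
    then show ?thesis using 2 by simp
  next
    case 3
    \<comment> \<open>At 0 the difference quotient is at most
      \<open>\<bar>h\<bar> powr (p - 1)\<close> in modulus, which tends to 0, the value of the
      formula there.\<close>
    have "((\<lambda>h. \<bar>h\<bar> powr (p - 1)) \<longlongrightarrow> \<bar>0::real\<bar> powr (p - 1)) (at 0)"
      using assms by (intro tendsto_powr' tendsto_intros) auto
    then have "((\<lambda>h. \<bar>h\<bar> powr (p - 1)) \<longlongrightarrow> 0) (at (0::real))" by simp
    then have "((\<lambda>h. \<bar>h\<bar> powr p / h) \<longlongrightarrow> 0) (at (0::real))"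
    proof (rule Lim_null_comparison[rotated])
      show "\<forall>\<^sub>F h in at (0::real). norm (\<bar>h\<bar> powr p / h) \<le> \<bar>h\<bar> powr (p - 1)"
        by (rule eventually_at_topological[THEN iffD2], rule exI[of _ UNIV])
           (auto simp: powr_diff)
    qed
    then show ?thesis using 3 by (simp add: DERIV_def)
  qed
qed

text \<open>Young's inequality with the conjugate exponents \<open>p\<close> and
  \<open>p / (p - 1)\<close>, applied to \<open>b\<close> and \<open>k powr (p - 1)\<close> and
  multiplied by \<open>p\<close> to clear fractions.\<close>

lemma Young_powr:
  fixes k b p :: real
  assumes "k \<ge> 0" "b \<ge> 0" "p > 1"
  shows "p * k powr (p - 1) * b \<le> (p - 1) * k powr p + b powr p"
proof -
  have q: "p / (p - 1) > 1" "1 / p + 1 / (p / (p - 1)) = 1" using assms by (auto simp: field_simps)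
  have "b * k powr (p - 1) \<le> b powr p / p + (k powr (p - 1)) powr (p / (p - 1)) / (p / (p - 1))"
    using assms q by (intro Youngs_inequality) auto
  then have "p * (b * k powr (p - 1)) \<le>
      p * (b powr p / p + (k powr (p - 1)) powr (p / (p - 1)) / (p / (p - 1)))"
    using assms by (intro mult_left_mono) auto
  also have "\<dots> = (p - 1) * k powr p + b powr p"
  proof -
    have "(p - 1) * (p / (p - 1)) = p" using assms by simp
    then have "(k powr (p - 1)) powr (p / (p - 1)) = k powr p" by (simp only: powr_powr)
    then show ?thesis using assms by (simp add: field_simps)
  qed
  finally show ?thesis by (simp add: mult_ac)
qed

text \<open>This is \<open>Young_powr\<close> with \<open>k = g * c / (s * L)\<close>, multiplied by
  the weight \<open>?w\<close> of the gradient term. The choice of \<open>k\<close> turns the left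
  side into the cross term of the derivative of \<Phi> and the first term on the right into a
  multiple of the Hardy integrand.\<close>

lemma weighted_Young:
  fixes a b c g p s L :: real
  assumes "c \<ge> 0" "b \<ge> 0" "p > 1" "g > 0" "s > 0" "L > 0"
  shows "p * g powr (p - 1) * c powr (p - 1) * b * s powr a * L powr (- (p * g)) \<le>
    (p - 1) * (g powr p * c powr p * s powr (a - 1) * L powr (- (p * g + 1)))
    + b powr p * s powr (a + p - 1) * L powr (- (p * g + 1 - p))"
proof -
  let ?w = "s powr (a + p - 1) * L powr (- (p * g + 1 - p))"
  let ?k = "g * c / (s * L)"
  \<comment> \<open>Used with \<open>q = p - 1\<close>, where the exponents of \<open>s\<close> and
    \<open>L\<close> become \<open>a\<close> and \<open>- (p * g)\<close>, and with
    \<open>q = p\<close>, where they become \<open>a - 1\<close> and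
    \<open>- (p * g + 1)\<close>.\<close>
  have e: "?k powr q * ?w = g powr q * c powr q * s powr (a + p - 1 - q) * L powr (- (p * g + 1 - p + q))" for q
    using assms by (simp add: powr_mult powr_divide powr_diff powr_add powr_minus field_simps)
  have "(p * ?k powr (p - 1) * b) * ?w \<le> ((p - 1) * ?k powr p + b powr p) * ?w"
    using assms by (intro mult_right_mono Young_powr) auto
  then have "p * b * (?k powr (p - 1) * ?w) \<le> (p - 1) * (?k powr p * ?w) + b powr p * ?w"
    by (simp only: algebra_simps)
  then show ?thesis unfolding e by (simp add: algebra_simps)
qed

text \<open>The derivative of \<open>ln (R / s)\<close> is \<open>- 1 / s\<close>, so a negative
  power of the logarithm contributes with a plus sign. With \<open>m = p * g\<close> this last term
  is the source of the Hardy term, and the middle one of the remainder.\<close>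

lemma DERIV_log_weight:
  fixes v :: "real \<Rightarrow> real"
  assumes v: "(v has_real_derivative d) (at s)" and "p > 1" "0 < s" "s < R"
  shows "((\<lambda>s. \<bar>v s\<bar> powr p * s powr a * ln (R / s) powr (- m)) has_real_derivative
    (p * \<bar>v s\<bar> powr (p - 1) * sgn (v s) * d * s powr a * ln (R / s) powr (- m)
     + a * (\<bar>v s\<bar> powr p * s powr (a - 1) * ln (R / s) powr (- m))
     + m * (\<bar>v s\<bar> powr p * s powr (a - 1) * ln (R / s) powr (- (m + 1))))) (at s)"
proof -
  have L: "ln (R / s) > 0" using assms by simp
  have 1: "((\<lambda>s. \<bar>v s\<bar> powr p) has_real_derivative p * \<bar>v s\<bar> powr (p - 1) * sgn (v s) * d) (at s)"
    using DERIV_chain2[OF DERIV_abs_powr[OF \<open>p > 1\<close>] v] .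
  have 2: "((\<lambda>s. s powr a) has_real_derivative a * s powr (a - 1)) (at s)"
    using assms by (auto intro!: derivative_eq_intros simp: powr_diff)
  have l: "((\<lambda>s. ln (R / s)) has_real_derivative - (1 / s)) (at s)"
    using assms by (auto intro!: derivative_eq_intros simp: field_simps power2_eq_square)
  have 3: "((\<lambda>s. ln (R / s) powr (- m)) has_real_derivative
      m * (ln (R / s) powr (- (m + 1)) / s)) (at s)"
    using DERIV_chain2[OF DERIV_powr[OF DERIV_ident L DERIV_const[of "- m"]] l] L
    by (simp add: powr_diff powr_minus powr_add field_simps)
  have sa: "s powr a = s * s powr (a - 1)" using assms by (simp add: powr_diff)
  show ?thesis
    by (rule DERIV_cong[OF DERIV_mult[OF DERIV_mult[OF 1 2] 3]]) 
       (use assms in \<open>simp add: sa field_simps\<close>)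
qed

text \<open>The coefficient \<open>a\<close> is split into its positive part on the left and its
  negative part on the right. Both integrands are then nonnegative for either sign of
  \<open>a\<close>, and the estimate can be stated in [0,\<infinity>].\<close>

lemma log_Hardy_interval:
  fixes v v' :: "real \<Rightarrow> real" and a g p \<epsilon> T R :: real
  defines "I1 \<equiv> \<lambda>s. \<bar>v s\<bar> powr p * s powr (a - 1) * ln (R / s) powr (- (p * g + 1))"
    and "I2 \<equiv> \<lambda>s. \<bar>v s\<bar> powr p * s powr (a - 1) * ln (R / s) powr (- (p * g))"
    and "P \<equiv> \<lambda>s. \<bar>v' s\<bar> powr p * s powr (a + p - 1) * ln (R / s) powr (- (p * g + 1 - p))"
  assumes p: "p > 1" and g: "g > 0" and R: "0 < \<epsilon>" "\<epsilon> \<le> T" "T < R"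
    and v: "\<And>s. s \<in> {\<epsilon>..T} \<Longrightarrow> (v has_real_derivative v' s) (at s)"
    and cont: "continuous_on {\<epsilon>..T} v'" and vT: "v T = 0"
  shows "(\<integral>\<^sup>+s\<in>{\<epsilon>..T}. ennreal (g powr p * I1 s + max a 0 * g powr (p - 1) * I2 s) \<partial>lborel) \<le>
    (\<integral>\<^sup>+s\<in>{\<epsilon>..T}. ennreal (P s + max (- a) 0 * g powr (p - 1) * I2 s) \<partial>lborel)"
proof -
  let ?F = "\<lambda>s. g powr p * I1 s + max a 0 * g powr (p - 1) * I2 s"
  let ?G = "\<lambda>s. P s + max (- a) 0 * g powr (p - 1) * I2 s"
  define \<Phi> where "\<Phi> s = g powr (p - 1) * (\<bar>v s\<bar> powr p * s powr a * ln (R / s) powr (- (p * g)))" for s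
  define \<Phi>' where "\<Phi>' s = g powr (p - 1) *
    (p * \<bar>v s\<bar> powr (p - 1) * sgn (v s) * v' s * s powr a * ln (R / s) powr (- (p * g))
     + a * I2 s + p * g * I1 s)" for s
  have pos: "s > 0" "ln (R / s) > 0" "R / s > 0" if "s \<in> {\<epsilon>..T}" for s
    using that R by auto
  have cv: "continuous_on {\<epsilon>..T} v"
    using v by (meson DERIV_isCont continuous_at_imp_continuous_on)
  have cont_powr: "continuous_on {\<epsilon>..T} (\<lambda>s. \<bar>v s\<bar> powr p)" "continuous_on {\<epsilon>..T} (\<lambda>s. \<bar>v' s\<bar> powr p)"
    using p by (intro continuous_on_powr' continuous_intros cv cont; simp)+
  have cL: "continuous_on {\<epsilon>..T} (\<lambda>s. ln (R / s))" "continuous_on {\<epsilon>..T} (\<lambda>s. s powr q)"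
     "continuous_on {\<epsilon>..T} (\<lambda>s. ln (R / s) powr q)" for q
    using pos R by (auto intro!: continuous_intros)
  have "continuous_on {\<epsilon>..T} ?F" "continuous_on {\<epsilon>..T} ?G"
    unfolding I1_def I2_def P_def by (intro continuous_on_add continuous_on_mult continuous_on_const cont_powr cL)+
  then have F: "(?F has_integral integral {\<epsilon>..T} ?F) {\<epsilon>..T}"
    and G: "(?G has_integral integral {\<epsilon>..T} ?G) {\<epsilon>..T}"
    by (auto intro: integrable_integral integrable_continuous_interval)
  have \<Phi>: "(\<Phi>' has_integral \<Phi> T - \<Phi> \<epsilon>) {\<epsilon>..T}"
  proof (rule fundamental_theorem_of_calculus[OF R(2)])
    fix s assume s: "s \<in> {\<epsilon>..T}"
    have "(\<Phi> has_real_derivative \<Phi>' s) (at s)"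
      unfolding \<Phi>_def \<Phi>'_def I1_def I2_def
      by (rule DERIV_cmult, rule DERIV_log_weight) (use v s p R in auto)
    then show "(\<Phi> has_vector_derivative \<Phi>' s) (at s within {\<epsilon>..T})"
      by (simp add: has_real_derivative_iff_has_vector_derivative has_vector_derivative_at_within)
  qed
  \<comment> \<open>Since \<open>g * g powr (p - 1) = g powr p\<close>, the derivative contains
    \<open>p\<close> copies of \<open>g powr p * I1\<close>. Young's inequality spends
    \<open>p - 1\<close> of them on the cross term, at the price of \<open>P\<close>; the one left
    over is the Hardy term.\<close>
  have le: "?F s \<le> ?G s + \<Phi>' s" if s: "s \<in> {\<epsilon>..T}" for s
  proof -
    let ?c = "g powr (p - 1)"
    let ?w = "p * ?c * \<bar>v s\<bar> powr (p - 1) * s powr a * ln (R / s) powr (- (p * g))"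
    have "?w * \<bar>v' s\<bar> \<le> (p - 1) * (g powr p * I1 s) + P s"
      using weighted_Young[OF abs_ge_zero abs_ge_zero p g pos(1,2)[OF s], of "v s" "v' s" a]
      by (simp add: I1_def P_def mult_ac)
    moreover have "?w * (sgn (v s) * v' s) \<ge> - (?w * \<bar>v' s\<bar>)"
    proof -
      have "sgn (v s) * v' s \<ge> - \<bar>v' s\<bar>" by (auto simp: sgn_if)
      then have "?w * (sgn (v s) * v' s) \<ge> ?w * (- \<bar>v' s\<bar>)"
        using p by (intro mult_left_mono) auto
      then show ?thesis by simp
    qed
    moreover have "\<Phi>' s = ?w * (sgn (v s) * v' s) + a * (?c * I2 s) + p * ((g * ?c) * I1 s)"
      by (simp add: \<Phi>'_def algebra_simps)
    moreover have "g * ?c = g powr p" using g by (simp add: powr_diff)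
    moreover have "max a 0 * (?c * I2 s) = max (- a) 0 * (?c * I2 s) + a * (?c * I2 s)"
      by (auto simp: max_def algebra_simps)
    ultimately show ?thesis by (simp add: algebra_simps)
  qed
  have "integral {\<epsilon>..T} ?F \<le> integral {\<epsilon>..T} ?G + (\<Phi> T - \<Phi> \<epsilon>)"
    using has_integral_le[OF F has_integral_add[OF G \<Phi>] le] .
  moreover have "\<Phi> T = 0" "\<Phi> \<epsilon> \<ge> 0" using vT by (auto simp: \<Phi>_def)
  ultimately have "integral {\<epsilon>..T} ?F \<le> integral {\<epsilon>..T} ?G" by simp
  moreover have "0 \<le> ?F s" "0 \<le> ?G s" for s
    by (auto simp: I1_def I2_def P_def)
  ultimately show ?thesis
    using nn_integral_has_integral_lebesgue'[OF _ F] nn_integral_has_integral_lebesgue'[OF _ G]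
    by (simp add: ennreal_leI)
qed

section \<open>Tools for passing from intervals to rays and to the ball\<close>

text \<open>Monotone convergence along the intervals \<open>{T / real (Suc n)..T}\<close>, which
  increase to the part of the half-line where \<open>f\<close> can be nonzero. Index 0 gives the
  degenerate interval \<open>{T..T}\<close>, still covered by the hypothesis.\<close>

lemma nn_integral_greaterThan_0_le:
  fixes f :: "real \<Rightarrow> ennreal" and T :: real
  assumes [measurable]: "f \<in> borel_measurable borel" and T: "T > 0" and f0: "\<And>s. s > T \<Longrightarrow> f s = 0"
    and le: "\<And>\<epsilon>. 0 < \<epsilon> \<Longrightarrow> \<epsilon> \<le> T \<Longrightarrow> (\<integral>\<^sup>+s\<in>{\<epsilon>..T}. f s \<partial>lborel) \<le> C"
  shows "(\<integral>\<^sup>+s\<in>{0<..}. f s \<partial>lborel) \<le> C"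
proof -
  define h where "h n s = f s * indicator {T / real (Suc n)..T} s" for n s
  have "(\<lambda>n. integral\<^sup>N lborel (h n)) \<longlonglongrightarrow> (\<integral>\<^sup>+s\<in>{0<..}. f s \<partial>lborel)"
  proof (rule nn_integral_LIMSEQ)
    show "incseq h"
    proof (intro incseq_SucI le_funI)
      fix n s
      have "{T / real (Suc n)..T} \<subseteq> {T / real (Suc (Suc n))..T}"
        using T by (intro atLeastatMost_subset_iff[THEN iffD2] disjI2 conjI divide_left_mono) auto
      then show "h n s \<le> h (Suc n) s"
        unfolding h_def by (intro mult_left_mono indicator_leI) auto
    qed
    show "h n \<in> borel_measurable lborel" for n unfolding h_def by measurable
    show "(\<lambda>n. h n s) \<longlonglongrightarrow> f s * indicator {0<..} s" for s
    proof (cases "0 < s \<and> s \<le> T")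
      case True
      have "(\<lambda>n. T / real (Suc n)) \<longlonglongrightarrow> 0"
        by (rule LIMSEQ_Suc[OF lim_const_over_n])
      then have "\<forall>\<^sub>F n in sequentially. T / real (Suc n) < s"
        using True by (auto dest: order_tendstoD(2))
      then have "\<forall>\<^sub>F n in sequentially. h n s = f s * indicator {0<..} s"
        by eventually_elim (use True in \<open>auto simp: h_def indicator_def\<close>)
      then show ?thesis by (rule tendsto_eventually)
    next
      case False
      have "h n s = 0" for n
      proof -
        have "0 < T / real (Suc n)" using T by simp
        with False show ?thesis unfolding h_def indicator_def by (simp only: atLeastAtMost_iff) auto
      qed
      moreover have "f s * indicator {0<..} s = 0"
        using False f0[of s] by (auto simp: indicator_def)
      ultimately show ?thesis by (simp only: tendsto_const)
    qed
  qed
  moreover have "integral\<^sup>N lborel (h n) \<le> C" for n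
    unfolding h_def using T by (intro le) (auto simp: field_simps)
  ultimately show ?thesis by (auto intro: LIMSEQ_le_const2)
qed

text \<open>As \<open>grad\<close> is a definite description, both existence and uniqueness of the
  gradient are required.\<close>

lemma GDERIV_grad:
  fixes u :: "'a::euclidean_space \<Rightarrow> real"
  assumes "u differentiable (at x)"
  shows "GDERIV u x :> grad u x"
proof -
  obtain u' where u': "(u has_derivative u') (at x)"
    using assms by (auto simp: differentiable_def)
  then interpret bounded_linear u' by (rule has_derivative_bounded_linear)
  \<comment> \<open>The vector representing the functional \<open>u'\<close> through the inner
    product.\<close>
  define D where "D = (\<Sum>b\<in>Basis. u' b *\<^sub>R b)"
  have "u' h = h \<bullet> D" for h
  proof -
    have "u' h = u' (\<Sum>b\<in>Basis. (h \<bullet> b) *\<^sub>R b)" by (simp add: euclidean_representation)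
    also have "\<dots> = (\<Sum>b\<in>Basis. (h \<bullet> b) * u' b)" by (simp add: sum scaleR)
    finally show ?thesis by (simp add: D_def inner_sum_right mult.commute)
  qed
  then have "u' = (\<lambda>h. h \<bullet> D)" by (rule ext)
  then have "GDERIV u x :> D"
    using u' by (simp add: gderiv_def)
  moreover have "g = g'" if "GDERIV u x :> g" "GDERIV u x :> g'" for g g'
  proof -
    have "(\<lambda>h. h \<bullet> g) = (\<lambda>h. h \<bullet> g')"
      using that unfolding gderiv_def by (rule has_derivative_unique)
    then have "(g - g') \<bullet> (g - g') = 0"
      by (metis inner_diff_right right_minus_eq)
    then show ?thesis by simp
  qed
  ultimately show ?thesis unfolding grad_def by (metis theI)
qed

lemma GDERIV_ray:
  assumes "GDERIV u (s *\<^sub>R e) :> w"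
  shows "((\<lambda>s. u (s *\<^sub>R e)) has_real_derivative w \<bullet> e) (at s)"
proof -
  have "((\<lambda>s. s *\<^sub>R e) has_derivative (\<lambda>t. t *\<^sub>R e)) (at s)"
    by (auto intro!: derivative_eq_intros)
  from has_derivative_compose[OF this assms[unfolded gderiv_def]]
  show ?thesis
    by (simp add: has_field_derivative_def inner_commute mult_commute_abs)
qed

text \<open>Absorbs the polar weight into the radial weights, producing the product form used in
  \<open>log_Hardy_interval\<close>.\<close>

lemma power_mult_log_weight:
  fixes s :: real
  assumes "s > 0" "n \<ge> 1"
  shows "s ^ (n - 1) * (A / (s powr c * L powr d)) = A * s powr (real n - 1 - c) * L powr (- d)"
proof -
  have eq: "s ^ (n - 1) = s powr (real n - 1)"
    using assms by (simp add: of_nat_diff flip: powr_realpow)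
  show ?thesis unfolding eq using assms(1) by (simp add: powr_diff powr_minus powr_add field_simps)
qed

text \<open>As \<open>f\<close> vanishes at 0, cutting off to the punctured ball, where
  \<open>f\<close> is continuous, or to the whole ball gives the same function.\<close>

lemma borel_measurable_ball_minus_zero:
  fixes f :: "'a::euclidean_space \<Rightarrow> real"
  assumes "continuous_on (ball 0 R - {0}) f" "f 0 = 0"
  shows "(\<lambda>x. ennreal (f x) * indicator (ball 0 R) x) \<in> borel_measurable borel"
proof -
  have "(\<lambda>x. indicator (ball 0 R - {0}) x *\<^sub>R f x) \<in> borel_measurable borel"
    using assms by (intro borel_measurable_continuous_on_indicator) auto
  then have "(\<lambda>x. ennreal (indicator (ball 0 R - {0}) x *\<^sub>R f x)) \<in> borel_measurable borel"
    by measurable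
  also have "(\<lambda>x. ennreal (indicator (ball 0 R - {0}) x *\<^sub>R f x)) =
      (\<lambda>x. ennreal (f x) * indicator (ball 0 R) x)"
    using assms by (auto simp: indicator_def)
  finally show ?thesis .
qed

lemma continuous_on_log_weight:
  fixes f :: "'a::euclidean_space \<Rightarrow> real"
  assumes "continuous_on (ball 0 R - {0}) f" and "p > 0"
  shows "continuous_on (ball 0 R - {0})
    (\<lambda>x. \<bar>f x\<bar> powr p / (norm x powr c * ln (R / norm x) powr d))"
proof -
  have L: "ln (R / norm x) > 0" "R / norm x > 0" "norm x \<noteq> 0" if "x \<in> ball 0 R - {0}" for x :: 'a
  proof -
    have "0 < norm x" "norm x < R" using that by auto
    then have "1 < R / norm x" by (simp only: less_divide_eq_1_pos)
    then show "ln (R / norm x) > 0" "R / norm x > 0" by (rule ln_gt_zero, linarith)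
    show "norm x \<noteq> 0" using that by simp
  qed
  have cf: "continuous_on (ball 0 R - {0}) (\<lambda>x. \<bar>f x\<bar> powr p)"
    using assms by (intro continuous_on_powr' continuous_intros; simp)
  have cn: "continuous_on (ball 0 R - {0}) (norm :: 'a \<Rightarrow> real)"
    by (intro continuous_intros)
  have "R / norm x \<noteq> 0" if "x \<in> ball 0 R - {0}" for x :: 'a using L(2)[OF that] by linarith
  then have cL: "continuous_on (ball 0 R - {0}) (\<lambda>x::'a. ln (R / norm x))"
    using L(3) by (intro continuous_on_ln continuous_on_divide continuous_on_const cn) blast+
  have ne: "ln (R / norm x) \<noteq> 0" if "x \<in> ball 0 R - {0}" for x :: 'a
    using L(1)[OF that] by linarith
  then have "norm x powr c * ln (R / norm x) powr d \<noteq> 0" if "x \<in> ball 0 R - {0}" for x :: 'a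
    using L(3)[OF that] that by (simp only: mult_eq_0_iff powr_eq_0_iff) blast
  then show ?thesis
    using L(3) ne by (intro continuous_on_divide[OF cf] continuous_on_mult continuous_on_powr cn cL
        continuous_on_const) blast+
qed

section \<open>The inequality on the ball with the coefficient split by sign\<close>

text \<open>The one-dimensional estimate on each ray, combined by
  \<open>nn_integral_mono_rays\<close>. Differentiability is asked only off the origin, so both
  classes of functions in the theorem are covered; no subtraction occurs, so no integral has to be
  finite.\<close>

lemma log_Hardy_ball:
  fixes u :: "'a::euclidean_space \<Rightarrow> real" and w :: "'a \<Rightarrow> 'a" and p g \<alpha> \<beta> R T :: real
  defines "a \<equiv> real DIM('a) - p - \<alpha>"
    and "I1 \<equiv> \<lambda>x. \<bar>u x\<bar> powr p / (norm x powr (\<alpha> + p) * ln (R / norm x) powr (\<beta> + p))"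
    and "I2 \<equiv> \<lambda>x. \<bar>u x\<bar> powr p / (norm x powr (p + \<alpha>) * ln (R / norm x) powr (\<beta> + p - 1))"
    and "P \<equiv> \<lambda>x. \<bar>w x \<bullet> (x /\<^sub>R norm x)\<bar> powr p / (norm x powr \<alpha> * ln (R / norm x) powr \<beta>)"
  assumes p: "p > 1" and g: "g > 0" and \<beta>: "\<beta> + p - 1 = p * g" and T: "0 < T" "T < R"
    and w: "\<And>x. x \<in> ball 0 R - {0} \<Longrightarrow> GDERIV u x :> w x"
    and cw: "continuous_on (ball 0 R - {0}) w" and u0: "\<And>x. T \<le> norm x \<Longrightarrow> u x = 0"
  shows "ennreal (g powr p) * (\<integral>\<^sup>+x\<in>ball 0 R. ennreal (I1 x) \<partial>lborel)
      + ennreal (max a 0 * g powr (p - 1)) * (\<integral>\<^sup>+x\<in>ball 0 R. ennreal (I2 x) \<partial>lborel)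
    \<le> (\<integral>\<^sup>+x\<in>ball 0 R. ennreal (P x) \<partial>lborel)
      + ennreal (max (- a) 0 * g powr (p - 1)) * (\<integral>\<^sup>+x\<in>ball 0 R. ennreal (I2 x) \<partial>lborel)"
proof -
  let ?B = "ball 0 R - {0::'a}"
  let ?F = "\<lambda>x. g powr p * I1 x + max a 0 * g powr (p - 1) * I2 x"
  let ?G = "\<lambda>x. P x + max (- a) 0 * g powr (p - 1) * I2 x"
  define lhs rhs where "lhs x = ennreal (?F x) * indicator (ball 0 R) x"
    and "rhs x = ennreal (?G x) * indicator (ball 0 R) x" for x
  have nn: "I1 x \<ge> 0" "I2 x \<ge> 0" "P x \<ge> 0" for x by (auto simp: I1_def I2_def P_def)
  have cu: "continuous_on ?B u"
    using w unfolding gderiv_def by (meson has_derivative_continuous continuous_at_imp_continuous_on)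
  have cI: "continuous_on ?B I1" "continuous_on ?B I2" "continuous_on ?B P"
    unfolding I1_def I2_def P_def using p
    by (intro continuous_on_log_weight cu cw continuous_intros; auto)+
  \<comment> \<open>Default values: \<open>0 powr c = 0\<close> for every \<open>c\<close>, and
    division by 0 gives 0.\<close>
  have zero: "I1 0 = 0" "I2 0 = 0" "P 0 = 0" by (auto simp: I1_def I2_def P_def)
  note [measurable] = cI(1)[THEN borel_measurable_ball_minus_zero, OF zero(1)]
    cI(2)[THEN borel_measurable_ball_minus_zero, OF zero(2)]
    cI(3)[THEN borel_measurable_ball_minus_zero, OF zero(3)]
  have F: "lhs x = ennreal (g powr p) * (ennreal (I1 x) * indicator (ball 0 R) x)
      + ennreal (max a 0 * g powr (p - 1)) * (ennreal (I2 x) * indicator (ball 0 R) x)" for x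
    unfolding lhs_def rhs_def using nn by (simp add: ennreal_plus ennreal_mult algebra_simps)
  have G: "rhs x = ennreal (P x) * indicator (ball 0 R) x
      + ennreal (max (- a) 0 * g powr (p - 1)) * (ennreal (I2 x) * indicator (ball 0 R) x)" for x
    unfolding lhs_def rhs_def using nn by (simp add: ennreal_plus ennreal_mult algebra_simps)
  have "(\<integral>\<^sup>+x. lhs x \<partial>lborel) \<le> (\<integral>\<^sup>+x. rhs x \<partial>lborel)"
  proof (rule nn_integral_mono_rays)
    show [measurable]: "lhs \<in> borel_measurable borel" and "rhs \<in> borel_measurable borel"
      by (subst measurable_cong[OF F] measurable_cong[OF G], measurable)+
    fix e :: 'a assume e: "norm e = 1"
    then have e0: "e \<noteq> 0" by auto
    define v v' where "v s = u (s *\<^sub>R e)" and "v' s = w (s *\<^sub>R e) \<bullet> e" for s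
    have D1: "DIM('a) \<ge> 1" using DIM_positive[where 'a='a] by linarith
    have in_B: "s *\<^sub>R e \<in> ?B" if "s > 0" "s < R" for s
      using that e e0 by auto
    have unit: "(s *\<^sub>R e) /\<^sub>R norm (s *\<^sub>R e) = e" if "s > 0" for s
      using that e by simp
    let ?I1 = "\<lambda>s. \<bar>v s\<bar> powr p * s powr (a - 1) * ln (R / s) powr (- (p * g + 1))"
    let ?I2 = "\<lambda>s. \<bar>v s\<bar> powr p * s powr (a - 1) * ln (R / s) powr (- (p * g))"
    let ?P = "\<lambda>s. \<bar>v' s\<bar> powr p * s powr (a + p - 1) * ln (R / s) powr (- (p * g + 1 - p))"
    have ray: "s ^ (DIM('a) - 1) * I1 (s *\<^sub>R e) = ?I1 s"
      "s ^ (DIM('a) - 1) * I2 (s *\<^sub>R e) = ?I2 s"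
      "s ^ (DIM('a) - 1) * P (s *\<^sub>R e) = ?P s" if s: "0 < s" for s
    proof -
      \<comment> \<open>The exponents of \<open>s\<close> after the polar weight is absorbed, and
        those of the logarithm rewritten by \<open>\<beta> + p - 1 = p * g\<close>.\<close>
      have exps: "real DIM('a) - 1 - (\<alpha> + p) = a - 1" "real DIM('a) - 1 - (p + \<alpha>) = a - 1"
        "real DIM('a) - 1 - \<alpha> = a + p - 1" "\<beta> + p = p * g + 1" "\<beta> = p * g + 1 - p"
        using \<beta> by (auto simp: a_def)
      have n: "norm (s *\<^sub>R e) = s" using s e by simp
      show "s ^ (DIM('a) - 1) * I1 (s *\<^sub>R e) = ?I1 s"
        unfolding I1_def n power_mult_log_weight[OF s D1] exps v_def by simp
      show "s ^ (DIM('a) - 1) * I2 (s *\<^sub>R e) = ?I2 s"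
        unfolding I2_def n power_mult_log_weight[OF s D1] \<beta> exps v_def by simp
      show "s ^ (DIM('a) - 1) * P (s *\<^sub>R e) = ?P s"
        unfolding P_def unit[OF s] unfolding n power_mult_log_weight[OF s D1] v'_def
        by (simp only: exps)
    qed
    have F_ray: "ennreal (s ^ (DIM('a) - 1)) * lhs (s *\<^sub>R e)
        = ennreal (g powr p * ?I1 s + max a 0 * g powr (p - 1) * ?I2 s)"
      and G_ray: "ennreal (s ^ (DIM('a) - 1)) * rhs (s *\<^sub>R e)
        = ennreal (?P s + max (- a) 0 * g powr (p - 1) * ?I2 s)" if "0 < s" "s < R" for s
    proof -
      have "s *\<^sub>R e \<in> ball 0 R" "s ^ (DIM('a) - 1) \<ge> 0" using in_B[OF that] that by auto
      then show "ennreal (s ^ (DIM('a) - 1)) * lhs (s *\<^sub>R e)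
          = ennreal (g powr p * ?I1 s + max a 0 * g powr (p - 1) * ?I2 s)"
        "ennreal (s ^ (DIM('a) - 1)) * rhs (s *\<^sub>R e)
          = ennreal (?P s + max (- a) 0 * g powr (p - 1) * ?I2 s)"
        unfolding ray[OF that(1), symmetric] lhs_def rhs_def using nn
        by (simp_all add: ennreal_mult[symmetric] algebra_simps)
    qed
    have f0: "ennreal (s ^ (DIM('a) - 1)) * lhs (s *\<^sub>R e) = 0" if "s > T" for s
      using that T e u0[of "s *\<^sub>R e"] by (simp add: lhs_def I1_def I2_def)
    have meas: "(\<lambda>s. ennreal (s ^ (DIM('a) - 1)) * lhs (s *\<^sub>R e)) \<in> borel_measurable borel"
      by measurable
    show "(\<integral>\<^sup>+s. ennreal (s ^ (DIM('a) - 1)) * lhs (s *\<^sub>R e) * indicator {0<..} s \<partial>lborel)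
      \<le> (\<integral>\<^sup>+s. ennreal (s ^ (DIM('a) - 1)) * rhs (s *\<^sub>R e) * indicator {0<..} s \<partial>lborel)"
    proof (rule nn_integral_greaterThan_0_le[OF meas T(1) f0])
      fix \<epsilon> assume \<epsilon>: "0 < \<epsilon>" "\<epsilon> \<le> T"
      have sR: "0 < s" "s < R" if "s \<in> {\<epsilon>..T}" for s using that \<epsilon> T by auto
      have "(\<integral>\<^sup>+s\<in>{\<epsilon>..T}. ennreal (s ^ (DIM('a) - 1)) * lhs (s *\<^sub>R e) \<partial>lborel)
        = (\<integral>\<^sup>+s\<in>{\<epsilon>..T}. ennreal (g powr p * ?I1 s + max a 0 * g powr (p - 1) * ?I2 s) \<partial>lborel)"
      proof (rule nn_integral_cong)
        fix s
        show "ennreal (s ^ (DIM('a) - 1)) * lhs (s *\<^sub>R e) * indicator {\<epsilon>..T} s =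
          ennreal (g powr p * ?I1 s + max a 0 * g powr (p - 1) * ?I2 s) * indicator {\<epsilon>..T} s"
          by (cases "s \<in> {\<epsilon>..T}") (simp_all only: F_ray[OF sR] indicator_simps mult_zero_right simp_thms)
      qed
      also have "\<dots> \<le> (\<integral>\<^sup>+s\<in>{\<epsilon>..T}. ennreal (?P s + max (- a) 0 * g powr (p - 1) * ?I2 s) \<partial>lborel)"
      proof (rule log_Hardy_interval[OF p g \<epsilon> T(2)])
        show "(v has_real_derivative v' s) (at s)" if "s \<in> {\<epsilon>..T}" for s
          unfolding v_def v'_def using that \<epsilon> T by (intro GDERIV_ray w in_B) auto
        show "continuous_on {\<epsilon>..T} v'" unfolding v'_def
          by (intro continuous_intros continuous_on_compose2[OF cw]) (use \<epsilon> T in_B in force)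
        show "v T = 0" using T e u0[of "T *\<^sub>R e"] by (simp add: v_def)
      qed
      \<comment> \<open>Enlarging the domain of a nonnegative integrand makes the bound independent
        of \<epsilon>.\<close>
      also have "\<dots> \<le> (\<integral>\<^sup>+s. ennreal (s ^ (DIM('a) - 1)) * rhs (s *\<^sub>R e) * indicator {0<..} s \<partial>lborel)"
      proof (rule nn_integral_mono)
        fix s
        show "ennreal (?P s + max (- a) 0 * g powr (p - 1) * ?I2 s) * indicator {\<epsilon>..T} s
          \<le> ennreal (s ^ (DIM('a) - 1)) * rhs (s *\<^sub>R e) * indicator {0<..} s"
        proof (cases "s \<in> {\<epsilon>..T}")
          case True
          then have "s \<in> {0<..}" using sR by simp
          with True show ?thesis by (simp only: G_ray[OF sR] indicator_simps order_refl)
        qed simp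
      qed
      finally show "(\<integral>\<^sup>+s\<in>{\<epsilon>..T}. ennreal (s ^ (DIM('a) - 1)) * lhs (s *\<^sub>R e) \<partial>lborel)
        \<le> (\<integral>\<^sup>+s. ennreal (s ^ (DIM('a) - 1)) * rhs (s *\<^sub>R e) * indicator {0<..} s \<partial>lborel)" .
    qed
  qed
  moreover have "(\<integral>\<^sup>+x. lhs x \<partial>lborel) = ennreal (g powr p) * (\<integral>\<^sup>+x\<in>ball 0 R. ennreal (I1 x) \<partial>lborel)
      + ennreal (max a 0 * g powr (p - 1)) * (\<integral>\<^sup>+x\<in>ball 0 R. ennreal (I2 x) \<partial>lborel)"
    by (subst nn_integral_cong[OF F], subst nn_integral_add, simp, simp, subst (1 2) nn_integral_cmult, simp_all only:)
       measurable
  moreover have "(\<integral>\<^sup>+x. rhs x \<partial>lborel) = (\<integral>\<^sup>+x\<in>ball 0 R. ennreal (P x) \<partial>lborel)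
      + ennreal (max (- a) 0 * g powr (p - 1)) * (\<integral>\<^sup>+x\<in>ball 0 R. ennreal (I2 x) \<partial>lborel)"
    by (subst nn_integral_cong[OF G], subst nn_integral_add, simp, simp, subst nn_integral_cmult, simp_all only:)
       measurable
  ultimately show ?thesis by (simp only:)
qed

section \<open>Consequences of compact support\<close>

lemma C1c_vanishes_outside_ball:
  assumes "u \<in> C1c \<Omega>" "\<Omega> \<subseteq> ball 0 R" "R > 0"
  obtains T where "0 < T" "T < R" "\<And>x. T \<le> norm x \<Longrightarrow> u x = 0"
proof -
  \<comment> \<open>Adding the origin keeps \<open>K\<close> nonempty when \<open>u\<close> is
    identically 0, so that the norm attains a maximum on it.\<close>
  define K where "K = insert 0 (closure {x. u x \<noteq> 0})"
  have K: "compact K" "K \<noteq> {}" "K \<subseteq> ball 0 R" "{x. u x \<noteq> 0} \<subseteq> K"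
    using assms closure_subset[of "{x. u x \<noteq> 0}"] by (auto simp: K_def C1c_def compact_insert)
  obtain z where z: "z \<in> K" "\<And>x. x \<in> K \<Longrightarrow> norm x \<le> norm z"
    using continuous_attains_sup[OF K(1,2), of norm] by (auto intro: continuous_intros)
  have zR: "norm z < R" using z K by auto
  define T where "T = (norm z + R) / 2"
  have "0 < T" "T < R" "norm z < T" using zR norm_ge_zero[of z] assms(3) unfolding T_def by (simp_all add: add_nonneg_pos)
  moreover have "u x = 0" if "T \<le> norm x" for x
    using that \<open>norm z < T\<close> z(2)[of x] K(4) by force
  ultimately show ?thesis using that by blast
qed

text \<open>The support is compact and avoids both the origin and the sphere of radius
  \<open>R\<close>, so the integrand is bounded; the ball has finite measure. This permits the
  remainder to be subtracted when its coefficient is negative.\<close>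

lemma C1c_nn_integral_finite:
  fixes u :: "'a::euclidean_space \<Rightarrow> real"
  assumes u: "u \<in> C1c (ball 0 R - {0})" and "p > 0"
  shows "(\<integral>\<^sup>+x\<in>ball 0 R. ennreal (\<bar>u x\<bar> powr p /
      (norm x powr c * ln (R / norm x) powr d)) \<partial>lborel) < \<infinity>"
proof -
  let ?I = "\<lambda>x. \<bar>u x\<bar> powr p / (norm x powr c * ln (R / norm x) powr d)"
  define K where "K = closure {x. u x \<noteq> 0}"
  have K: "compact K" "K \<subseteq> ball 0 R - {0}" "{x. u x \<noteq> 0} \<subseteq> K"
    using u closure_subset[of "{x. u x \<noteq> 0}"] by (auto simp: K_def C1c_def)
  have "continuous_on (ball 0 R - {0}) u"
    using u by (auto simp: C1c_def intro!: continuous_at_imp_continuous_on differentiable_imp_continuous_within)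
  then have "continuous_on K ?I"
    by (intro continuous_on_subset[OF continuous_on_log_weight K(2)] assms)
  then have "bounded (?I ` K)" using K(1) by (intro compact_imp_bounded compact_continuous_image)
  then obtain C where C: "\<And>x. x \<in> K \<Longrightarrow> ?I x \<le> C" "C > 0"
    unfolding bounded_pos by force
  have "?I x \<le> C" for x
  proof (cases "x \<in> K")
    case False
    then have "u x = 0" using K(3) by blast
    then show ?thesis using C(2) by simp
  qed (rule C(1))
  then have le: "ennreal (?I x) * indicator (ball 0 R) x \<le> ennreal C * indicator (ball 0 R) x" for x
    by (intro mult_right_mono ennreal_leI) auto
  have "(\<integral>\<^sup>+x\<in>ball 0 R. ennreal (?I x) \<partial>lborel) \<le> (\<integral>\<^sup>+x\<in>ball (0::'a) R. ennreal C \<partial>lborel)"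
    by (rule nn_integral_mono[OF le])
  also have "\<dots> = ennreal C * emeasure lborel (ball (0::'a) R)"
    by (simp add: nn_integral_cmult_indicator)
  also have "\<dots> < \<infinity>"
    using emeasure_bounded_finite[of "ball (0::'a) R"] by (simp add: ennreal_mult_less_top)
  finally show ?thesis .
qed

section \<open>Return to extended reals and a signed remainder\<close>

theorem theorem3:
  fixes R p \<alpha> \<beta> :: real and u :: "real ^ 'n \<Rightarrow> real"
  assumes "CARD('n) \<ge> 2" and "R > 0" and "p > 1" and "\<beta> \<ge> 1 - p"
    and "(\<alpha> \<le> real CARD('n) - p \<and> u \<in> C1c (ball 0 R)) \<or>
         (\<alpha> > real CARD('n) - p \<and> u \<in> C1c (ball 0 R - {0}))"
  shows "ereal (((\<beta> + p - 1) / p) powr p) *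
           ball_integral R (\<lambda>x. \<bar>u x\<bar> powr p /
             (norm x powr (\<alpha> + p) * ln (R / norm x) powr (\<beta> + p)))
         + psi_tilde R p \<alpha> \<beta> u
         \<le> ball_integral R (\<lambda>x. \<bar>grad u x \<bullet> (x /\<^sub>R norm x)\<bar> powr p /
             (norm x powr \<alpha> * ln (R / norm x) powr \<beta>))"
proof -
  define g a where "g = (\<beta> + p - 1) / p" and "a = real CARD('n) - p - \<alpha>"
  define X1 X2 Y where
    "X1 = (\<integral>\<^sup>+x\<in>ball 0 R. ennreal (\<bar>u x\<bar> powr p /
      (norm x powr (\<alpha> + p) * ln (R / norm x) powr (\<beta> + p))) \<partial>lborel)"
    and "X2 = (\<integral>\<^sup>+x\<in>ball 0 R. ennreal (\<bar>u x\<bar> powr p /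
      (norm x powr (p + \<alpha>) * ln (R / norm x) powr (\<beta> + p - 1))) \<partial>lborel)"
    and "Y = (\<integral>\<^sup>+x\<in>ball 0 R. ennreal (\<bar>grad u x \<bullet> (x /\<^sub>R norm x)\<bar> powr p /
      (norm x powr \<alpha> * ln (R / norm x) powr \<beta>)) \<partial>lborel)"
  have "ereal (g powr p) * enn2ereal X1 + ereal (a * g powr (p - 1)) * enn2ereal X2 \<le> enn2ereal Y"
  proof (cases "g = 0")
    \<comment> \<open>Here \<open>\<beta> = 1 - p\<close>: both prefactors on the left are 0, and
      \<open>0 * \<infinity> = 0\<close>, so only nonnegativity of the right side is left.\<close>
    case True
    then show ?thesis by (simp flip: zero_ereal_def)
  next
    case False
    then have g: "g > 0" using assms by (simp add: g_def)
    have pg: "\<beta> + p - 1 = p * g" using assms by (simp add: g_def)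
    \<comment> \<open>One set stands for the ball or the punctured ball, so the two hypotheses on
      \<open>u\<close> are treated together.\<close>
    obtain \<Omega> where \<Omega>: "u \<in> C1c \<Omega>" "\<Omega> \<subseteq> ball 0 R" "ball 0 R - {0} \<subseteq> \<Omega>"
      using assms(5) by blast
    then have d: "GDERIV u x :> grad u x" if "x \<in> ball 0 R - {0}" for x
      using that by (intro GDERIV_grad) (auto simp: C1c_def)
    have c: "continuous_on (ball 0 R - {0}) (grad u)"
      using \<Omega> by (auto simp: C1c_def intro: continuous_on_subset)
    obtain T where T: "0 < T" "T < R" "\<And>x. T \<le> norm x \<Longrightarrow> u x = 0"
      using C1c_vanishes_outside_ball[OF \<Omega>(1,2) assms(2)] by blast
    have H: "ennreal (g powr p) * X1 + ennreal (max a 0 * g powr (p - 1)) * X2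
        \<le> Y + ennreal (max (- a) 0 * g powr (p - 1)) * X2"
      using log_Hardy_ball[OF assms(3) g pg T(1,2) d c T(3), of \<alpha>]
      by (simp add: X1_def X2_def Y_def a_def)
    show ?thesis
    proof (cases "a \<ge> 0")
      \<comment> \<open>The negative part of \<open>a\<close> is 0, so \<open>H\<close> is already
        the claim and infinite integrals are harmless.\<close>
      case True
      then have "enn2ereal (ennreal (g powr p) * X1 + ennreal (a * g powr (p - 1)) * X2) \<le> enn2ereal Y"
        using H by (simp add: less_eq_ennreal.rep_eq[symmetric])
      then show ?thesis
        using True by (simp add: plus_ennreal.rep_eq times_ennreal.rep_eq enn2ereal_ennreal)
    next
      case False
      \<comment> \<open>A negative \<open>a\<close> means
        \<open>\<alpha> > real CARD('n) - p\<close>, so the support of \<open>u\<close> avoids the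
        origin.\<close>
      then have "X2 < \<infinity>"
        unfolding X2_def using assms by (intro C1c_nn_integral_finite) (auto simp: a_def)
      then obtain r where r: "X2 = ennreal r" "r \<ge> 0" by (cases X2) auto
      have "enn2ereal (ennreal (g powr p) * X1) \<le> enn2ereal (Y + ennreal (- a * g powr (p - 1)) * X2)"
        using H False by (simp add: less_eq_ennreal.rep_eq[symmetric] max_def)
      then have "ereal (g powr p) * enn2ereal X1 \<le> enn2ereal Y + ereal (- a * g powr (p - 1) * r)"
        using r False by (simp add: plus_ennreal.rep_eq times_ennreal.rep_eq enn2ereal_ennreal
            mult_nonpos_nonneg)
      \<comment> \<open>The term moved across is a real number, so the step is valid even where the
        other two are infinite.\<close>
      then have "ereal (g powr p) * enn2ereal X1 + ereal (a * g powr (p - 1) * r) \<le> enn2ereal Y"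
        by (cases "ereal (g powr p) * enn2ereal X1"; cases "enn2ereal Y") auto
      then show ?thesis using r by (simp add: enn2ereal_ennreal)
    qed
  qed
  then show ?thesis
    by (simp add: ball_integral_def psi_tilde_def X1_def X2_def Y_def a_def g_def)
qed

end
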